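(* Let $b>0$, $I=(0,1)$, and for $\lambda>0$ consider the problem $$-\left(\int_0^1 |u(x)|^2\,dx+b\right) u''(x) = \lambda u(x)^2 \ \ (x\in I),\qquad u(x)>0\ \ (x\in I),\qquad u(0)=u(1)=0. \quad (P)$$ Put $\lambda_0 := 2b^{1/2}\|W_2\|_2$. (i) If $0<\lambda<\lambda_0$, then $(P)$ has no solution. (ii) If $\lambda=\lambda_0$, then $(P)$ has a unique solution, namely $$u_\lambda(x)=\frac{\lambda_0}{2}\|W_2\|_2^{-2}W_2(x).$$ (iii) If $\lambda>\lambda_0$, then $(P)$ has exactly two solutions $u_{1,\lambda},u_{2,\lambda}$, and they are given by $$u_{1,\lambda}(x)=\frac{\lambda\|W_2\|_2^{-1}-\sqrt{\lambda^2\|W_2\|_2^{-2}-4b}}{2}\,\|W_2\|_2^{-1}W_2(x),$$ $$u_{2,\lambda}(x)=\frac{\lambda\|W_2\|_2^{-1}+\sqrt{\lambda^2\|W_2\|_2^{-2}-4b}}{2}\,\|W_2\|_2^{-1}W_2(x).$$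
   Context: Solutions are classical: $u\in C^2(I)\cap C([0,1])$. $W_2$ denotes the unique solution (existence and uniqueness are known) of $-W''(x)=W(x)^2$ for $x\in(0,1)$, $W(x)>0$ for $x\in(0,1)$, $W(0)=W(1)=0$. $\|u\|_2=\left(\int_0^1|u(x)|^2dx\right)^{1/2}$. *)

theory Defs
  imports "HOL-Analysis.Analysis"
begin

text \<open>A function on \<open>[0,1]\<close> is represented by a total function \<open>real \<Rightarrow> real\<close> whose values outside
  \<open>[0,1]\<close> are irrelevant: every notion below depends only on the values on \<open>[0,1]\<close>.\<close>

text \<open>Meant for open \<open>S\<close>, where the two-sided \<^const>\<open>deriv\<close> only depends on the values on \<open>S\<close>.
  Continuity of \<open>f\<close> and \<open>deriv f\<close> is implied.\<close>
definition C2_on :: "real set \<Rightarrow> (real \<Rightarrow> real) \<Rightarrow> bool" where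
  "C2_on S f \<longleftrightarrow>
     (\<forall>x\<in>S. f differentiable at x) \<and>
     (\<forall>x\<in>S. deriv f differentiable at x) \<and>
     continuous_on S (deriv (deriv f))"

definition positive_dirichlet :: "(real \<Rightarrow> real) \<Rightarrow> bool" where
  "positive_dirichlet u \<longleftrightarrow>
     C2_on {0<..<1} u \<and> continuous_on {0..1} u \<and>
     (\<forall>x\<in>{0<..<1}. u x > 0) \<and> u 0 = 0 \<and> u 1 = 0"

text \<open>\<open>W\<close> plays the role of \<open>W\<^sub>2\<close>. This problem determines it only on \<open>[0,1]\<close>, so it is kept as a
  parameter throughout rather than fixed by a description operator.\<close>
definition W2_solution :: "(real \<Rightarrow> real) \<Rightarrow> bool" where
  "W2_solution W \<longleftrightarrow>
     positive_dirichlet W \<and> (\<forall>x\<in>{0<..<1}. - deriv (deriv W) x = (W x)\<^sup>2)"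

definition P_solution :: "real \<Rightarrow> real \<Rightarrow> (real \<Rightarrow> real) \<Rightarrow> bool" where
  "P_solution b lam u \<longleftrightarrow>
     positive_dirichlet u \<and>
     (\<forall>x\<in>{0<..<1}.
        - (integral {0..1} (\<lambda>t. \<bar>u t\<bar>\<^sup>2) + b) * deriv (deriv u) x = lam * (u x)\<^sup>2)"

definition norm2 :: "(real \<Rightarrow> real) \<Rightarrow> real" where
  "norm2 u = sqrt (integral {0..1} (\<lambda>x. \<bar>u x\<bar>\<^sup>2))"

definition eq01 :: "(real \<Rightarrow> real) \<Rightarrow> (real \<Rightarrow> real) \<Rightarrow> bool" where
  "eq01 u v \<longleftrightarrow> (\<forall>x\<in>{0..1}. u x = v x)"

definition lambda0 :: "real \<Rightarrow> (real \<Rightarrow> real) \<Rightarrow> real" where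
  "lambda0 b W = 2 * sqrt b * norm2 W"

definition u_crit :: "real \<Rightarrow> (real \<Rightarrow> real) \<Rightarrow> real \<Rightarrow> real" where
  "u_crit b W x = lambda0 b W / 2 * inverse ((norm2 W)\<^sup>2) * W x"

definition u_minus :: "real \<Rightarrow> (real \<Rightarrow> real) \<Rightarrow> real \<Rightarrow> real \<Rightarrow> real" where
  "u_minus b W lam x =
     (lam * inverse (norm2 W) - sqrt (lam\<^sup>2 * inverse ((norm2 W)\<^sup>2) - 4 * b)) / 2
       * inverse (norm2 W) * W x"

definition u_plus :: "real \<Rightarrow> (real \<Rightarrow> real) \<Rightarrow> real \<Rightarrow> real \<Rightarrow> real" where
  "u_plus b W lam x =
     (lam * inverse (norm2 W) + sqrt (lam\<^sup>2 * inverse ((norm2 W)\<^sup>2) - 4 * b)) / 2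
       * inverse (norm2 W) * W x"

end

theory Submission imports Defs begin

text \<open>Dividing a solution of \<open>(P)\<close> by the constant \<open>m = (\<parallel>u\<parallel>\<^sup>2 + b) / \<lambda>\<close> gives a positive solution
  of \<open>-v'' = v\<^sup>2\<close>, so \<open>u = m W\<close> by uniqueness, and the consistency condition is the
  quadratic \<open>\<parallel>W\<parallel>\<^sup>2 m\<^sup>2 - \<lambda> m + b = 0\<close>. Its discriminant \<open>\<lambda>\<^sup>2 - 4 b \<parallel>W\<parallel>\<^sup>2\<close> changes sign at \<open>\<lambda>\<^sub>0\<close>.

  For the uniqueness of \<open>W\<close>, let \<open>u\<close> and \<open>v\<close> be two solutions with maxima at \<open>p\<close> and \<open>q\<close>.
  The equation is invariant under \<open>u \<mapsto> s\<^sup>2 u (s (x - q) + p)\<close>, and \<open>s\<close> can be chosen such that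
  the rescaled \<open>u\<close> has the same value and the same (zero) slope at \<open>q\<close> as \<open>v\<close>. The two then agree
  wherever both are defined; comparing their zeros forces \<open>s = 1\<close> and \<open>p = q\<close>.\<close>

section \<open>Twice differentiable functions and rescaling\<close>

text \<open>Passes from explicit derivatives to iterated \<open>deriv\<close>. Since
  \<open>deriv f\<close> agrees with \<open>f1\<close> only on \<open>S\<close>, openness is what
  lets the derivative of \<open>f1\<close> carry over to \<open>deriv f\<close>.\<close>

lemma C2_onI:
  assumes "open S"
    and f: "\<And>x. x \<in> S \<Longrightarrow> (f has_real_derivative f1 x) (at x)"
    and f1: "\<And>x. x \<in> S \<Longrightarrow> (f1 has_real_derivative f2 x) (at x)"
    and "continuous_on S f2"
  shows "C2_on S f" and "\<And>x. x \<in> S \<Longrightarrow> deriv (deriv f) x = f2 x"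
proof -
  have d1: "deriv f x = f1 x" if "x \<in> S" for x
    using f[OF that] by (rule DERIV_imp_deriv)
  have d2: "(deriv f has_real_derivative f2 x) (at x)" if "x \<in> S" for x
    using has_field_derivative_transform_within_open[OF f1[OF that] \<open>open S\<close> that] d1 by simp
  show d3: "\<And>x. x \<in> S \<Longrightarrow> deriv (deriv f) x = f2 x"
    using d2 by (rule DERIV_imp_deriv)
  have "continuous_on S (deriv (deriv f))"
    using assms(4) d3 by (simp cong: continuous_on_cong)
  then show "C2_on S f"
    unfolding C2_on_def using f d2 real_differentiable_def by blast
qed

lemma C2_onD:
  assumes "C2_on S f" "x \<in> S"
  shows "(f has_real_derivative deriv f x) (at x)"
    and "(deriv f has_real_derivative deriv (deriv f) x) (at x)"
  using assms by (auto simp: C2_on_def DERIV_deriv_iff_real_differentiable)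

text \<open>Formulated with \<open>eq01\<close> because a solution is known only up to its values
  outside the unit interval; the open interval still determines both derivatives.\<close>

lemma positive_dirichlet_scale:
  assumes u: "positive_dirichlet u" and "c > 0" and eq: "eq01 v (\<lambda>x. c * u x)"
  shows "positive_dirichlet v"
    and "\<And>x. x \<in> {0<..<1} \<Longrightarrow> deriv (deriv v) x = c * deriv (deriv u) x"
proof -
  let ?I = "{0<..<1::real}"
  have C2: "C2_on ?I u" using u by (simp add: positive_dirichlet_def)
  have v: "(v has_real_derivative c * deriv u x) (at x)" if "x \<in> ?I" for x
  proof (rule has_field_derivative_transform_within_open)
    show "((\<lambda>x. c * u x) has_real_derivative c * deriv u x) (at x)"
      using C2_onD(1)[OF C2 that] by (rule DERIV_cmult)
    show "open ?I" "x \<in> ?I" using that by auto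
    show "c * u y = v y" if "y \<in> ?I" for y using eq that by (simp add: eq01_def)
  qed
  have v': "((\<lambda>x. c * deriv u x) has_real_derivative c * deriv (deriv u) x) (at x)"
    if "x \<in> ?I" for x
    using C2_onD(2)[OF C2 that] by (rule DERIV_cmult)
  have cont: "continuous_on ?I (\<lambda>x. c * deriv (deriv u) x)"
    using C2 by (intro continuous_intros) (simp add: C2_on_def)
  note * = C2_onI[OF open_greaterThanLessThan v v' cont]
  show "\<And>x. x \<in> ?I \<Longrightarrow> deriv (deriv v) x = c * deriv (deriv u) x"
    using *(2) .
  have "continuous_on {0..1} (\<lambda>x. c * u x)"
    using u by (intro continuous_intros) (simp add: positive_dirichlet_def)
  then have "continuous_on {0..1} v"
    by (rule continuous_on_eq) (use eq in \<open>simp add: eq01_def\<close>)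
  then show "positive_dirichlet v"
    using *(1) u eq \<open>c > 0\<close> by (simp add: positive_dirichlet_def eq01_def)
qed

section \<open>Uniqueness of the profile \<open>W\<close>\<close>

text \<open>A Gronwall argument for the energy \<open>f = w^2 + w1^2\<close>, which vanishes at
  \<open>q\<close> and satisfies \<open>|f'| \<le> M f\<close>. Assuming only a linear bound on
  \<open>w2\<close> makes it applicable to the difference of two solutions of a nonlinear
  equation.\<close>

lemma second_order_ivp_zero:
  fixes w w1 w2 :: "real \<Rightarrow> real"
  assumes w: "\<And>x. x \<in> {l<..<r} \<Longrightarrow> (w has_real_derivative w1 x) (at x)"
    and w1: "\<And>x. x \<in> {l<..<r} \<Longrightarrow> (w1 has_real_derivative w2 x) (at x)"
    and w2: "\<And>x. x \<in> {l<..<r} \<Longrightarrow> \<bar>w2 x\<bar> \<le> K * \<bar>w x\<bar>"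
    and q: "q \<in> {l<..<r}" "w q = 0" "w1 q = 0" and x: "x \<in> {l<..<r}"
  shows "w x = 0"
proof -
  define f where "f x = (w x)\<^sup>2 + (w1 x)\<^sup>2" for x
  define f1 where "f1 x = 2 * w x * w1 x + 2 * w1 x * w2 x" for x
  have f: "(f has_real_derivative f1 y) (at y)" if "y \<in> {l<..<r}" for y
    unfolding f_def f1_def
    by (rule derivative_eq_intros w w1 that refl | simp)+
  define M where "M = 1 + \<bar>K\<bar>"
  have bound: "\<bar>f1 y\<bar> \<le> M * f y" if "y \<in> {l<..<r}" for y
  proof -
    have "\<bar>w2 y\<bar> \<le> \<bar>K\<bar> * \<bar>w y\<bar>"
      using w2[OF that] by (smt (verit) abs_ge_zero mult_right_mono)
    then have "\<bar>w1 y * w2 y\<bar> \<le> \<bar>w1 y\<bar> * (\<bar>K\<bar> * \<bar>w y\<bar>)"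
      by (simp add: abs_mult mult_left_mono)
    then have "\<bar>f1 y\<bar> \<le> (1 + \<bar>K\<bar>) * (2 * \<bar>w y\<bar> * \<bar>w1 y\<bar>)"
      unfolding f1_def using abs_triangle_ineq[of "2 * w y * w1 y" "2 * w1 y * w2 y"]
      by (simp add: abs_mult algebra_simps)
    also have "\<dots> \<le> (1 + \<bar>K\<bar>) * f y"
      using sum_squares_bound[of "\<bar>w y\<bar>" "\<bar>w1 y\<bar>"]
      by (intro mult_left_mono) (auto simp: f_def)
    finally show ?thesis unfolding M_def .
  qed
  \<comment> \<open>Integrating factor: \<open>c = - M\<close> makes the product nonincreasing to
    the right of \<open>q\<close>, and \<open>c = M\<close> makes it nondecreasing to the
    left.\<close>
  have e: "((\<lambda>x. f x * exp (c * x)) has_real_derivative (f1 y + c * f y) * exp (c * y)) (at y)"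
    if "y \<in> {l<..<r}" for y c
    by (rule derivative_eq_intros f that refl | simp add: algebra_simps)+
  have "f x \<le> 0"
  proof (cases "q \<le> x")
    case True
    have "f x * exp (- M * x) \<le> f q * exp (- M * q)"
    proof (rule DERIV_nonpos_imp_nonincreasing[OF True])
      fix y assume "q \<le> y" "y \<le> x"
      then have y: "y \<in> {l<..<r}" using q x by auto
      show "\<exists>d. ((\<lambda>x. f x * exp (- M * x)) has_real_derivative d) (at y) \<and> d \<le> 0"
        using e[OF y, of "- M"] bound[OF y]
        by (intro exI conjI) (auto simp: mult_le_0_iff)
    qed
    then show ?thesis using q by (simp add: f_def mult_le_0_iff)
  next
    case False
    then have "x \<le> q" by simp
    have "f x * exp (M * x) \<le> f q * exp (M * q)"
    proof (rule DERIV_nonneg_imp_nondecreasing[OF \<open>x \<le> q\<close>])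
      fix y assume "x \<le> y" "y \<le> q"
      then have y: "y \<in> {l<..<r}" using q x by auto
      show "\<exists>d. ((\<lambda>x. f x * exp (M * x)) has_real_derivative d) (at y) \<and> 0 \<le> d"
        using e[OF y, of M] bound[OF y]
        by (intro exI conjI) (auto simp: zero_le_mult_iff)
    qed
    then show ?thesis using q by (simp add: f_def mult_le_0_iff)
  qed
  then show ?thesis
    by (simp add: f_def) (smt (verit) zero_le_power2 power2_eq_square mult_eq_0_iff)
qed

lemma positive_dirichlet_max:
  assumes "positive_dirichlet u"
  obtains p where "p \<in> {0<..<1}" "deriv u p = 0" "\<And>x. x \<in> {0..1} \<Longrightarrow> u x \<le> u p"
proof -
  have "continuous_on {0..1} u" "{0..1::real} \<noteq> {}"
    using assms by (auto simp: positive_dirichlet_def)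
  then obtain p where p: "p \<in> {0..1}" "\<And>x. x \<in> {0..1} \<Longrightarrow> u x \<le> u p"
    using continuous_attains_sup[of "{0..1::real}" u] by auto
  \<comment> \<open>The maximum is positive, so it is not attained at an endpoint.\<close>
  have "u p \<ge> u (1/2)" "u (1/2) > 0"
    using p assms by (auto simp: positive_dirichlet_def)
  then have p': "p \<in> {0<..<1}"
    using p assms by (cases "p = 0"; cases "p = 1") (auto simp: positive_dirichlet_def)
  have "deriv u p = 0"
  proof (rule DERIV_local_max)
    show "(u has_real_derivative deriv u p) (at p)"
      using C2_onD(1) p' assms by (auto simp: positive_dirichlet_def)
    show "0 < min p (1 - p)" using p' by auto
    show "\<forall>y. \<bar>p - y\<bar> < min p (1 - p) \<longrightarrow> u y \<le> u p"
      by (auto intro!: p(2))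
  qed
  then show thesis using that p' p by blast
qed

lemma W2_solution_unique:
  assumes u: "W2_solution u" and v: "W2_solution v"
  shows "eq01 v u"
proof -
  let ?I = "{0<..<1::real}"
  have pu: "positive_dirichlet u" and pv: "positive_dirichlet v"
    using u v by (auto simp: W2_solution_def)
  obtain p where p: "p \<in> ?I" "deriv u p = 0" and pmax: "\<And>x. x \<in> {0..1} \<Longrightarrow> u x \<le> u p"
    using positive_dirichlet_max[OF pu] by blast
  obtain q where q: "q \<in> ?I" "deriv v q = 0" and qmax: "\<And>x. x \<in> {0..1} \<Longrightarrow> v x \<le> v q"
    using positive_dirichlet_max[OF pv] by blast
  have upos: "u x > 0" if "x \<in> ?I" for x using pu that by (auto simp: positive_dirichlet_def)
  have vpos: "v x > 0" if "x \<in> ?I" for x using pv that by (auto simp: positive_dirichlet_def)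
  have C2u: "C2_on ?I u" and C2v: "C2_on ?I v"
    and cu: "continuous_on {0..1} u" and cv: "continuous_on {0..1} v"
    and bc: "u 0 = 0" "u 1 = 0" "v 0 = 0" "v 1 = 0"
    using pu pv by (auto simp: positive_dirichlet_def)
  have u2: "deriv (deriv u) x = - (u x)\<^sup>2" if "x \<in> ?I" for x
    using u that by (force simp: W2_solution_def)
  have v2: "deriv (deriv v) x = - (v x)\<^sup>2" if "x \<in> ?I" for x
    using v that by (force simp: W2_solution_def)
  define s where "s = sqrt (v q / u p)"
  have "v q > 0" "u p > 0" using vpos upos p q by auto
  then have s: "s > 0" and s2: "s\<^sup>2 * u p = v q"
    by (auto simp: s_def)
  define h where "h x = s * (x - q) + p" for x
  define z where "z x = s\<^sup>2 * u (h x)" for x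
  \<comment> \<open>The affine map \<open>h\<close> sends \<open>q - p / s\<close> to 0 and
    \<open>q + (1 - p) / s\<close> to 1. Thus \<open>l\<close> and \<open>r\<close> bound the points
    of the unit interval that \<open>h\<close> maps back into it.\<close>
  define l where "l = max 0 (q - p / s)"
  define r where "r = min 1 (q + (1 - p) / s)"
  have "p / s > 0" "(1 - p) / s > 0" using p s by auto
  then have lr: "l < q" "q < r" "0 \<le> l" "r \<le> 1" using q by (auto simp: l_def r_def)
  have hI: "h x \<in> ?I" if "x \<in> {l<..<r}" for x
    using that s by (auto simp: l_def r_def h_def field_simps)
  have hI': "h x \<in> {0..1}" if "x \<in> {l..r}" for x
    using that s by (auto simp: l_def r_def h_def field_simps)
  have h: "(h has_real_derivative s) (at x)" for x
    unfolding h_def by (rule derivative_eq_intros refl | simp)+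
  \<comment> \<open>The second derivative of \<open>v - z\<close> is
    \<open>z^2 - v^2 = (z + v)(z - v)\<close>. Both functions lie between 0 and their common maximum
    \<open>v q\<close>, whence the constant \<open>2 * v q\<close>.\<close>
  have agree: "v x - z x = 0" if "x \<in> {l<..<r}" for x
  proof (rule second_order_ivp_zero[where w = "\<lambda>x. v x - z x" and q = q and K = "2 * v q"])
    fix x assume x: "x \<in> {l<..<r}"
    then have xI: "x \<in> ?I" using lr by auto
    show "((\<lambda>x. v x - z x) has_real_derivative deriv v x - s\<^sup>2 * (deriv u (h x) * s)) (at x)"
      unfolding z_def
      by (intro DERIV_diff DERIV_cmult DERIV_chain2 h C2_onD(1)[OF C2v] C2_onD(1)[OF C2u] hI x xI)
    have "((\<lambda>x. deriv v x - s\<^sup>2 * (deriv u (h x) * s)) has_real_derivative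
        deriv (deriv v) x - s\<^sup>2 * (deriv (deriv u) (h x) * s * s)) (at x)"
      by (intro DERIV_diff DERIV_cmult DERIV_cmult_right DERIV_chain2 h
          C2_onD(2)[OF C2v] C2_onD(2)[OF C2u] hI x xI)
    also have "deriv (deriv v) x - s\<^sup>2 * (deriv (deriv u) (h x) * s * s) = (z x)\<^sup>2 - (v x)\<^sup>2"
      unfolding u2[OF hI[OF x]] v2[OF xI] z_def by (simp add: power2_eq_square algebra_simps)
    finally show "((\<lambda>x. deriv v x - s\<^sup>2 * (deriv u (h x) * s)) has_real_derivative
        (z x)\<^sup>2 - (v x)\<^sup>2) (at x)" .
    have "z x \<le> v q" "z x > 0"
      using pmax[of "h x"] hI[OF x] s upos s2 unfolding z_def
      by (auto simp flip: s2)
    then have "\<bar>z x + v x\<bar> \<le> 2 * v q"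
      using qmax[of x] vpos xI by force
    moreover have "\<bar>(z x)\<^sup>2 - (v x)\<^sup>2\<bar> = \<bar>z x + v x\<bar> * \<bar>v x - z x\<bar>"
      by (subst abs_minus_commute)
        (simp add: power2_eq_square square_diff_square_factored abs_mult add.commute)
    ultimately show "\<bar>(z x)\<^sup>2 - (v x)\<^sup>2\<bar> \<le> 2 * v q * \<bar>v x - z x\<bar>"
      by (simp add: mult_right_mono)
  qed (use lr that p q s2 in \<open>auto simp: z_def h_def\<close>)
  \<comment> \<open>Continuity extends the agreement to the endpoints, where the zeros are
    compared.\<close>
  have "v x - z x = 0" if "x \<in> {l..r}" for x
  proof (rule continuous_constant_on_closure[where S = "{l<..<r}" and f = "\<lambda>x. v x - z x"])
    have "continuous_on {l..r} h"
      unfolding h_def by (intro continuous_intros)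
    then have "continuous_on {l..r} (\<lambda>x. v x - s\<^sup>2 * u (h x))"
      by (intro continuous_intros continuous_on_subset[OF cv] continuous_on_compose2[OF cu])
        (use lr hI' in auto)
    then show "continuous_on (closure {l<..<r}) (\<lambda>x. v x - z x)"
      using lr by (simp add: closure_greaterThanLessThan z_def)
    show "x \<in> closure {l<..<r}" using that lr by (simp add: closure_greaterThanLessThan)
  qed (use agree in auto)
  then have vz: "v x = s\<^sup>2 * u (h x)" if "x \<in> {l..r}" for x
    using that by (fastforce simp: z_def)
  \<comment> \<open>Compare left zeros. If \<open>q * s > p\<close>, then \<open>h l = 0\<close> at
    an interior point \<open>l\<close>, where \<open>v\<close> would vanish; if
    \<open>q * s < p\<close>, then \<open>h 0\<close> is interior and \<open>u\<close> would vanish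
    there. The right zeros are treated symmetrically below.\<close>
  have "q * s = p"
  proof (rule ccontr)
    assume "q * s \<noteq> p"
    then consider "q * s > p" | "q * s < p" by linarith
    then show False
    proof cases
      case 1
      then have l: "l = q - p / s" "l > 0" using s by (auto simp: l_def field_simps)
      then have "h l = 0" using s by (simp add: h_def)
      then have "v l = 0" using vz[of l] lr bc by simp
      then show False using vpos[of l] l lr q by auto
    next
      case 2
      then have l: "l = 0" using s by (simp add: l_def field_simps)
      have "q * s > 0" using q s by simp
      then have "h 0 \<in> ?I" using 2 p by (auto simp: h_def mult.commute)
      moreover have "u (h 0) = 0" using vz[of 0] lr l bc s by simp
      ultimately show False using upos[of "h 0"] by simp
    qed
  qed
  moreover have "(1 - q) * s = 1 - p"
  proof (rule ccontr)
    assume "(1 - q) * s \<noteq> 1 - p"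
    then consider "(1 - q) * s > 1 - p" | "(1 - q) * s < 1 - p" by linarith
    then show False
    proof cases
      case 1
      then have r: "r = q + (1 - p) / s" "r < 1" using s by (auto simp: r_def field_simps)
      then have "h r = 1" using s by (simp add: h_def)
      then have "v r = 0" using vz[of r] lr bc by simp
      then show False using vpos[of r] r lr q by auto
    next
      case 2
      then have r: "r = 1" using s by (simp add: r_def field_simps)
      have "(1 - q) * s > 0" using q s by simp
      then have "h 1 \<in> ?I" using 2 p by (auto simp: h_def mult.commute)
      moreover have "u (h 1) = 0" using vz[of 1] lr r bc s by simp
      ultimately show False using upos[of "h 1"] by simp
    qed
  qed
  \<comment> \<open>Adding the two equations gives \<open>s = 1\<close>; then \<open>h\<close> is
    the identity, \<open>l = 0\<close> and \<open>r = 1\<close>.\<close>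
  ultimately have "s = 1" "p = q" by (auto simp: algebra_simps)
  then show ?thesis
    using vz by (simp add: eq01_def l_def r_def h_def)
qed

section \<open>Reduction of the nonlocal problem to a quadratic equation\<close>

lemma positive_dirichlet_integral_pos:
  assumes "positive_dirichlet u"
  shows "integral {0..1} (\<lambda>x. \<bar>u x\<bar>\<^sup>2) > 0"
proof -
  have c: "continuous_on {0..1} (\<lambda>x. (u x)\<^sup>2)"
    using assms by (intro continuous_intros) (simp add: positive_dirichlet_def)
  have "integral {0..1} (\<lambda>x. (u x)\<^sup>2) \<noteq> 0"
  proof
    assume "integral {0..1} (\<lambda>x. (u x)\<^sup>2) = 0"
    then have "((\<lambda>x. (u x)\<^sup>2) has_integral 0) {0..1}"
      using integrable_integral[OF integrable_continuous_real[OF c]] by simp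
    then have "(u (1/2))\<^sup>2 = 0"
      using has_integral_0_cbox_imp_0[of 0 1 "\<lambda>x. (u x)\<^sup>2" "1/2"] c by simp
    then show False
      using assms by (auto simp: positive_dirichlet_def dest: bspec[of _ _ "1/2"])
  qed
  moreover have "integral {0..1} (\<lambda>x. (u x)\<^sup>2) \<ge> 0"
    by (rule integral_nonneg[OF integrable_continuous_real[OF c]]) simp
  ultimately show ?thesis by simp
qed

lemma integral_square_scale:
  assumes "eq01 u (\<lambda>x. m * W x)"
  shows "integral {0..1} (\<lambda>x. \<bar>u x\<bar>\<^sup>2) = m\<^sup>2 * integral {0..1} (\<lambda>x. \<bar>W x\<bar>\<^sup>2)"
proof -
  have "integral {0..1} (\<lambda>x. \<bar>u x\<bar>\<^sup>2) = integral {0..1} (\<lambda>x. m\<^sup>2 * \<bar>W x\<bar>\<^sup>2)"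
    using assms by (intro integral_cong) (simp add: eq01_def power_mult_distrib)
  then show ?thesis by simp
qed

lemma P_solution_iff:
  assumes "b > 0" "lam > 0" and W: "W2_solution W"
  shows "P_solution b lam u \<longleftrightarrow>
    (\<exists>m. m\<^sup>2 * (norm2 W)\<^sup>2 + b = lam * m \<and> eq01 u (\<lambda>x. m * W x))"
proof -
  have pW: "positive_dirichlet W"
    and W2: "\<And>x. x \<in> {0<..<1} \<Longrightarrow> deriv (deriv W) x = - (W x)\<^sup>2"
    using W by (force simp: W2_solution_def)+
  have N: "(norm2 W)\<^sup>2 = integral {0..1} (\<lambda>x. \<bar>W x\<bar>\<^sup>2)"
    using positive_dirichlet_integral_pos[OF pW] by (simp add: norm2_def)
  show ?thesis
  proof
    assume P: "P_solution b lam u"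
    define m where "m = (integral {0..1} (\<lambda>t. \<bar>u t\<bar>\<^sup>2) + b) / lam"
    have pu: "positive_dirichlet u" using P by (simp add: P_solution_def)
    have m: "m > 0"
      using positive_dirichlet_integral_pos[OF pu] assms by (simp add: m_def)
    have lm: "integral {0..1} (\<lambda>t. \<bar>u t\<bar>\<^sup>2) + b = lam * m"
      using assms by (simp add: m_def)
    have u2: "m * deriv (deriv u) x = - (u x)\<^sup>2" if "x \<in> {0<..<1}" for x
    proof -
      have "- (lam * m) * deriv (deriv u) x = lam * (u x)\<^sup>2"
        using P that unfolding P_solution_def lm by blast
      then have "lam * (m * deriv (deriv u) x) = lam * (- (u x)\<^sup>2)" by simp
      then show ?thesis using \<open>lam > 0\<close> by (simp only: mult_cancel_left) simp
    qed
    define v where "v x = inverse m * u x" for x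
    have v: "positive_dirichlet v"
      "\<And>x. x \<in> {0<..<1} \<Longrightarrow> deriv (deriv v) x = inverse m * deriv (deriv u) x"
      using positive_dirichlet_scale[OF pu, of "inverse m" v] m by (auto simp: eq01_def v_def)
    have "- deriv (deriv v) x = (v x)\<^sup>2" if "x \<in> {0<..<1}" for x
      using u2[OF that] m unfolding v(2)[OF that]
      by (simp add: v_def power2_eq_square field_simps)
    then have "eq01 v W"
      using v(1) W by (intro W2_solution_unique) (auto simp: W2_solution_def)
    then have "eq01 u (\<lambda>x. m * W x)"
      using m by (auto simp: eq01_def v_def field_simps)
    then show "\<exists>m. m\<^sup>2 * (norm2 W)\<^sup>2 + b = lam * m \<and> eq01 u (\<lambda>x. m * W x)"
      using lm integral_square_scale N by metis
  next
    assume "\<exists>m. m\<^sup>2 * (norm2 W)\<^sup>2 + b = lam * m \<and> eq01 u (\<lambda>x. m * W x)"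
    then obtain m where m: "m\<^sup>2 * (norm2 W)\<^sup>2 + b = lam * m" and eq: "eq01 u (\<lambda>x. m * W x)"
      by blast
    \<comment> \<open>Positivity of \<open>m\<close> need not be demanded in the statement: the left
      side of the quadratic is at least \<open>b\<close>.\<close>
    have "lam * m > 0" using m \<open>b > 0\<close> by (smt (verit) mult_nonneg_nonneg zero_le_power2)
    then have "m > 0" using \<open>lam > 0\<close> by (simp add: zero_less_mult_iff)
    note u = positive_dirichlet_scale[OF pW this eq]
    have "integral {0..1} (\<lambda>t. \<bar>u t\<bar>\<^sup>2) + b = lam * m"
      using integral_square_scale[OF eq] N m by simp
    moreover have "u x = m * W x" if "x \<in> {0<..<1}" for x
      using eq that by (simp add: eq01_def)
    ultimately show "P_solution b lam u"
      using u W2 by (simp add: P_solution_def power2_eq_square)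
  qed
qed

lemma monic_quadratic_iff:
  fixes t c b :: real
  assumes "c\<^sup>2 \<ge> 4 * b"
  shows "t\<^sup>2 + b = c * t \<longleftrightarrow>
    t = (c - sqrt (c\<^sup>2 - 4 * b)) / 2 \<or> t = (c + sqrt (c\<^sup>2 - 4 * b)) / 2"
proof -
  define d where "d = sqrt (c\<^sup>2 - 4 * b)"
  have "d\<^sup>2 = c\<^sup>2 - 4 * b" using assms by (simp add: d_def)
  then have "4 * (t\<^sup>2 + b - c * t) = (2 * t - c + d) * (2 * t - c - d)"
    by (simp add: power2_eq_square algebra_simps)
  then have "t\<^sup>2 + b = c * t \<longleftrightarrow> 2 * t - c + d = 0 \<or> 2 * t - c - d = 0"
    by (metis eq_iff_diff_eq_0 mult_eq_0_iff zero_neq_numeral)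
  then show ?thesis unfolding d_def[symmetric] by auto
qed

section \<open>Counting the roots\<close>

theorem theorem1p2:
  fixes b lam :: real and W :: "real \<Rightarrow> real"
  assumes "b > 0" and "lam > 0" and "W2_solution W"
  shows "(lam < lambda0 b W \<longrightarrow> \<not> (\<exists>u. P_solution b lam u)) \<and>
    (lam = lambda0 b W \<longrightarrow>
       (\<forall>u. P_solution b lam u \<longleftrightarrow> eq01 u (u_crit b W))) \<and>
    (lam > lambda0 b W \<longrightarrow>
       \<not> eq01 (u_minus b W lam) (u_plus b W lam) \<and>
       (\<forall>u. P_solution b lam u \<longleftrightarrow>
          eq01 u (u_minus b W lam) \<or> eq01 u (u_plus b W lam)))"
proof -
  define N where "N = norm2 W"
  have pW: "positive_dirichlet W" using assms by (simp add: W2_solution_def)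
  have N: "N > 0"
    using positive_dirichlet_integral_pos[OF pW] by (simp add: N_def norm2_def)
  define c where "c = lam / N"
  have c: "c > 0" using N assms by (simp add: c_def)
  \<comment> \<open>The substitution \<open>t = m * N\<close> makes the quadratic monic, with roots
    of the form in which \<open>u_minus\<close> and \<open>u_plus\<close> are written.\<close>
  have P: "P_solution b lam u \<longleftrightarrow>
      (\<exists>t. t\<^sup>2 + b = c * t \<and> eq01 u (\<lambda>x. t * inverse N * W x))" (is "_ = ?R") for u
  proof
    assume "P_solution b lam u"
    then obtain m where m: "m\<^sup>2 * N\<^sup>2 + b = lam * m" "eq01 u (\<lambda>x. m * W x)"
      using P_solution_iff[OF assms] by (auto simp: N_def)
    then show ?R
      using N by (intro exI[of _ "m * N"]) (simp add: c_def power_mult_distrib mult.assoc)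
  next
    assume ?R
    then obtain t where t: "t\<^sup>2 + b = c * t" "eq01 u (\<lambda>x. t * inverse N * W x)" by blast
    moreover have "(t * inverse N)\<^sup>2 * N\<^sup>2 = t\<^sup>2" "lam * (t * inverse N) = c * t"
      using N by (auto simp: c_def field_simps)
    ultimately show "P_solution b lam u"
      using P_solution_iff[OF assms] by (metis N_def)
  qed
  have c_eq: "lam * inverse N = c" "lam\<^sup>2 * inverse (N\<^sup>2) = c\<^sup>2"
    by (simp_all add: c_def power_divide flip: divide_inverse)
  have minus: "u_minus b W lam = (\<lambda>x. (c - sqrt (c\<^sup>2 - 4 * b)) / 2 * inverse N * W x)"
    and plus: "u_plus b W lam = (\<lambda>x. (c + sqrt (c\<^sup>2 - 4 * b)) / 2 * inverse N * W x)"
    unfolding fun_eq_iff u_minus_def u_plus_def N_def[symmetric] c_eq by simp_all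
  have crit: "u_crit b W = (\<lambda>x. sqrt b * inverse N * W x)"
    unfolding fun_eq_iff u_crit_def lambda0_def N_def[symmetric]
    using N by (simp add: power2_eq_square)
  have sb: "(2 * sqrt b)\<^sup>2 = 4 * b" using \<open>b > 0\<close> by simp
  have lam0: "lam < lambda0 b W \<longleftrightarrow> c < 2 * sqrt b" "lam = lambda0 b W \<longleftrightarrow> c = 2 * sqrt b"
    "lam > lambda0 b W \<longleftrightarrow> c > 2 * sqrt b"
    using N by (auto simp: lambda0_def N_def[symmetric] c_def field_simps)
  have "\<not> P_solution b lam u" if "c < 2 * sqrt b" for u
  proof
    assume "P_solution b lam u"
    then obtain t where "t\<^sup>2 + b = c * t" using P by blast
    \<comment> \<open>Completing the square: below the threshold the discriminant is negative and no
      real \<open>t\<close> exists.\<close>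
    then have "(2 * t - c)\<^sup>2 = c\<^sup>2 - 4 * b" by (simp add: power2_eq_square algebra_simps)
    moreover have "c\<^sup>2 < 4 * b"
      using power_strict_mono[OF that, of 2] c sb by simp
    ultimately show False by (smt (verit) zero_le_power2)
  qed
  moreover have "P_solution b lam u \<longleftrightarrow> eq01 u (u_crit b W)" if "c = 2 * sqrt b" for u
  proof -
    have c2: "c\<^sup>2 = 4 * b" using sb that by simp
    then have "t\<^sup>2 + b = c * t \<longleftrightarrow> t = sqrt b" for t
      using monic_quadratic_iff[of b c t] that by auto
    then show ?thesis unfolding P crit by simp
  qed
  moreover have "\<not> eq01 (u_minus b W lam) (u_plus b W lam)"
    "P_solution b lam u \<longleftrightarrow> eq01 u (u_minus b W lam) \<or> eq01 u (u_plus b W lam)"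
    if "c > 2 * sqrt b" for u
  proof -
    have c2: "c\<^sup>2 > 4 * b"
      using power_strict_mono[OF that, of 2] sb \<open>b > 0\<close> by simp
    show "P_solution b lam u \<longleftrightarrow> eq01 u (u_minus b W lam) \<or> eq01 u (u_plus b W lam)"
      unfolding P minus plus monic_quadratic_iff[OF less_imp_le[OF c2]] by blast
    \<comment> \<open>The two roots differ, so the two multiples of \<open>W\<close> differ wherever
      \<open>W\<close> is nonzero, for instance at \<open>1/2\<close>.\<close>
    have "W (1/2) > 0" using pW by (simp add: positive_dirichlet_def)
    then show "\<not> eq01 (u_minus b W lam) (u_plus b W lam)"
      unfolding minus plus eq01_def using c2 N by (intro notI) (drule bspec[of _ _ "1/2"]; simp)
  qed
  ultimately show ?thesis unfolding lam0 by blast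
qed

end
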